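(* Let $n\ge2$, $E=\{1,2,\dots,n\}$, and let $X=((X_t)_{t\ge0},(P_i)_{i\in E})$ be a continuous-time Markov chain with state space $E$, lifetime $\zeta$ and $Q$-matrix $Q=(q_{ij})_{i,j\in E}$ satisfying: (1) $0<-q_{ii}<\infty$ for all $i\in E$; (2) $q_{ij}>0$ for all $i,j\in E$ with $i\neq j$; (3) $\sum_{j\in E}q_{ij}\le 0$ for all $i\in E$. Let $\mathcal{P}_1(E)$ be the set of all probability measures on $E$. Then for every $i_0\in E$, $$\lim_{t\to\infty}\frac1t\log P_{i_0}(t<\zeta)=\sup_{\mu\in\mathcal{P}_1(E)}\left\{\inf_{u>0}\sum_{i\in E}\sum_{j\in E}\frac{q_{ij}\,\mu(\{i\})\,u(j)}{u(i)}\right\},$$ where the infimum is over all functions $u:E\to\mathbb{R}$ with $u(i)>0$ for every $i\in E$.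
   Context: The chain $X$ may have finite lifetime: it is killed at the random time $\zeta\in(0,\infty]$, after which it is no longer in $E$ (it is in a cemetery state); under $P_i$ it starts at $i$, and its transition function on $E$ is generated by $Q$, i.e. $P_i(X_t=j,\ t<\zeta)=(e^{tQ})_{ij}$ for $i,j\in E$, $t\ge 0$. In particular $P_i(t<\zeta)=\sum_{j\in E}(e^{tQ})_{ij}$. The matrix $Q$ is not assumed conservative or symmetric. *)

theory Defs
  imports "HOL-Probability.Probability"
begin

text \<open>The type \<^typ>\<open>real ^ 'n ^ 'n\<close> carries the componentwise product, so the overloaded
  power and exponential functions are not those of the matrix algebra.\<close>

primrec matrix_power :: "real ^ 'n ^ 'n \<Rightarrow> nat \<Rightarrow> real ^ 'n ^ 'n" where
  "matrix_power A 0 = mat 1"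
| "matrix_power A (Suc k) = A ** matrix_power A k"

definition matrix_exp :: "real ^ 'n ^ 'n \<Rightarrow> real ^ 'n ^ 'n" where
  "matrix_exp A = (\<Sum>k. matrix_power A k /\<^sub>R fact k)"

text \<open>The events determined by \<open>(X r)\<close> for \<open>r \<in> [0, s]\<close>, as subsets of \<open>\<Omega>\<close>.\<close>

definition history :: "'w set \<Rightarrow> (real \<Rightarrow> 'w \<Rightarrow> 'a) \<Rightarrow> real \<Rightarrow> 'w set set" where
  "history \<Omega> X s = sigma_sets \<Omega> {X r -` B \<inter> \<Omega> | r B. 0 \<le> r \<and> r \<le> s}"

text \<open>A time-homogeneous continuous-time Markov chain on the finite state space \<^typ>\<open>'n\<close>, killed
  at the time \<open>\<zeta> \<in> (0, \<infinity>]\<close>. The value \<^const>\<open>None\<close> is the cemetery state. All the laws \<open>P i\<close> live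
  on the measurable space underlying \<open>M\<close>; the measure that \<open>M\<close> itself carries plays no role.\<close>

locale killed_markov_chain =
  fixes M :: "'w measure"
    and P :: "'n::finite \<Rightarrow> 'w measure"
    and X :: "real \<Rightarrow> 'w \<Rightarrow> 'n option"
    and \<zeta> :: "'w \<Rightarrow> ereal"
    and Q :: "real ^ 'n ^ 'n"
  assumes law: "P i \<in> space (prob_algebra M)"
    and X_measurable: "0 \<le> t \<Longrightarrow> X t \<in> M \<rightarrow>\<^sub>M count_space UNIV"
    and lifetime_measurable: "\<zeta> \<in> borel_measurable M"
    and lifetime_pos: "\<omega> \<in> space M \<Longrightarrow> 0 < \<zeta> \<omega>"
    and killed_iff: "\<omega> \<in> space M \<Longrightarrow> 0 \<le> t \<Longrightarrow> X t \<omega> = None \<longleftrightarrow> \<zeta> \<omega> \<le> ereal t"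
    and start: "\<P>(\<omega> in P i. X 0 \<omega> = Some i) = 1"
    and transition: "0 \<le> t \<Longrightarrow>
      \<P>(\<omega> in P i. X t \<omega> = Some j \<and> ereal t < \<zeta> \<omega>) = matrix_exp (t *\<^sub>R Q) $ i $ j"
    and markov: "0 \<le> s \<Longrightarrow> 0 \<le> t \<Longrightarrow> A \<in> history (space M) X s \<Longrightarrow>
      \<P>(\<omega> in P i. \<omega> \<in> A \<and> X s \<omega> = Some k \<and> X (s + t) \<omega> = Some j) =
      \<P>(\<omega> in P i. \<omega> \<in> A \<and> X s \<omega> = Some k) * \<P>(\<omega> in P k. X t \<omega> = Some j)"

end

theory Submission
  imports Defs
begin

text \<open>Both sides equal the Perron eigenvalue \<open>\<lambda>\<close> of \<open>Q\<close>. Since the off-diagonal entries of \<open>Q\<close> are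
  positive, there are strictly positive vectors \<open>v\<close> and \<open>w\<close> with \<open>Q v = \<lambda> v\<close> and
  \<open>w\<^sup>T Q = \<lambda> w\<^sup>T\<close>; see \<open>perron_pair\<close>.

  On the probabilistic side, \<open>e\<^bsup>tQ\<^esup> v = e\<^bsup>t\<lambda>\<^esup> v\<close>, and the entries of \<open>e\<^bsup>tQ\<^esup>\<close> are nonnegative because
  they are transition probabilities. Comparing \<open>v\<close> with the constant function \<open>1\<close> shows that the
  survival probability, which is a row sum of \<open>e\<^bsup>tQ\<^esup>\<close>, lies between two constant multiples of
  \<open>e\<^bsup>t\<lambda>\<^esup>\<close>. Its exponential rate is therefore \<open>\<lambda>\<close>.

  On the variational side, the test function \<open>u = v\<close> gives the value \<open>\<lambda>\<close> for every \<open>\<mu>\<close>, so the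
  supremum is at most \<open>\<lambda>\<close>. It is attained at \<open>\<mu>(i)\<close> proportional to \<open>w(i) v(i)\<close>: writing
  \<open>u = v e\<^sup>g\<close> and using \<open>e\<^sup>x \<ge> 1 + x\<close> off the diagonal, the terms linear in \<open>g\<close> cancel by the two
  eigenvector equations, and no \<open>u\<close> gives less than \<open>\<lambda>\<close>.\<close>


section \<open>Positive eigenvectors\<close>

text \<open>Normalising \<open>A x\<close> to total mass one maps the probability simplex continuously into itself;
  a Brouwer fixed point is an eigenvector, and it is strictly positive because \<open>A\<close> maps nonzero
  nonnegative vectors to strictly positive ones.\<close>

lemma positive_matrix_positive_eigenvector:
  fixes A :: "real ^ 'n ^ 'n"
  assumes A: "\<And>i j. A $ i $ j > 0"
  shows "\<exists>v r. (\<forall>i. v $ i > 0) \<and> A *v v = r *\<^sub>R v"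
proof -
  define S where "S = {x :: real ^ 'n. (\<forall>i. 0 \<le> x $ i) \<and> (\<Sum>i\<in>UNIV. x $ i) = 1}"
  define s where "s x = (\<Sum>i\<in>UNIV. (A *v x) $ i)" for x
  define g where "g x = (1 / s x) *\<^sub>R (A *v x)" for x
  have pos: "(A *v x) $ i > 0" if x: "x \<in> S" for x i
  proof -
    have "\<exists>j. x $ j \<noteq> 0"
    proof (rule ccontr)
      assume "\<not> ?thesis"
      then have "(\<Sum>i\<in>UNIV. x $ i) = 0" by simp
      with x show False by (simp add: S_def)
    qed
    then obtain j where "x $ j > 0"
      using x by (force simp: S_def less_le)
    then have "(\<Sum>j\<in>UNIV. A $ i $ j * x $ j) > 0"
      using x A by (intro sum_pos2[of UNIV j]) (auto simp: S_def less_imp_le)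
    then show ?thesis by (simp add: matrix_vector_mult_def)
  qed
  have spos: "s x > 0" if "x \<in> S" for x
    unfolding s_def using pos[OF that] by (intro sum_pos) auto
  have "bounded S"
    unfolding bounded_iff
  proof (intro exI ballI)
    fix x assume "x \<in> S"
    then show "norm x \<le> 1"
      using norm_le_l1_cart[of x] by (auto simp: S_def)
  qed
  moreover have "closed S"
  proof -
    have "S = (\<Inter>i. {x. 0 \<le> x $ i}) \<inter> {x. (\<Sum>i\<in>UNIV. x $ i) = 1}"
      by (auto simp: S_def)
    then show ?thesis
      by (auto intro!: closed_Collect_le closed_Collect_eq continuous_intros)
  qed
  ultimately have "compact S" by (simp add: compact_eq_bounded_closed)
  moreover have "convex S"
    by (auto simp: convex_def S_def sum.distrib simp flip: sum_distrib_left)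
  moreover have "axis undefined 1 \<in> S"
    by (auto simp: S_def axis_def)
  then have "S \<noteq> {}" by blast
  moreover have "continuous_on S g"
  proof -
    have "continuous_on S (\<lambda>x. A *v x)"
      by (intro linear_continuous_on matrix_vector_mul_bounded_linear)
    moreover have "s x \<noteq> 0" if "x \<in> S" for x using spos[OF that] by simp
    ultimately show ?thesis
      unfolding g_def s_def by (intro continuous_intros) auto
  qed
  moreover have "g \<in> S \<rightarrow> S"
  proof (rule Pi_I)
    fix x assume x: "x \<in> S"
    have "(\<Sum>i\<in>UNIV. g x $ i) = 1"
      using spos[OF x] unfolding g_def by (simp add: s_def flip: sum_divide_distrib)
    then show "g x \<in> S"
      using spos[OF x] pos[OF x] by (auto simp: S_def g_def less_imp_le)
  qed
  ultimately obtain x where x: "x \<in> S" "g x = x"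
    using brouwer[of S g] by blast
  have "A *v x = s x *\<^sub>R g x" using spos[OF x(1)] by (simp add: g_def)
  then have eq: "A *v x = s x *\<^sub>R x" using x by simp
  have "x $ i > 0" for i
    using pos[OF x(1), of i] spos[OF x(1)] unfolding eq by (simp add: zero_less_mult_iff)
  with eq show ?thesis by blast
qed

text \<open>Adding a large multiple of the identity makes the matrix positive and does not change its
  eigenvectors.\<close>

lemma positive_eigenvector:
  fixes Q :: "real ^ 'n ^ 'n"
  assumes Q: "\<And>i j. i \<noteq> j \<Longrightarrow> Q $ i $ j > 0"
  shows "\<exists>v l. (\<forall>i. v $ i > 0) \<and> Q *v v = l *\<^sub>R v"
proof -
  define c where "c = 1 + (\<Sum>i\<in>UNIV. \<bar>Q $ i $ i\<bar>)"
  have c: "Q $ i $ i + c > 0" for i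
  proof -
    have "\<bar>Q $ i $ i\<bar> \<le> (\<Sum>i\<in>UNIV. \<bar>Q $ i $ i\<bar>)" by (rule member_le_sum) auto
    then show ?thesis by (simp add: c_def)
  qed
  have "(Q + mat c) $ i $ j > 0" for i j
    using Q[of i j] c[of i] by (cases "i = j") (auto simp: mat_def)
  then obtain v r where v: "\<forall>i. v $ i > 0" "(Q + mat c) *v v = r *\<^sub>R v"
    using positive_matrix_positive_eigenvector by blast
  have "(mat c :: real ^ 'n ^ 'n) *v v = c *\<^sub>R v"
    by (simp add: vec_eq_iff matrix_vector_mult_def mat_def if_distrib[of "\<lambda>x. x * _"] cong: if_cong)
  then have "Q *v v = (r - c) *\<^sub>R v"
    using v(2) by (simp add: matrix_vector_mult_add_rdistrib algebra_simps)
  with v show ?thesis by blast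
qed

text \<open>The right and the left eigenvalue coincide, since both are \<open>w\<^sup>T Q v / w\<^sup>T v\<close> and
  \<open>w\<^sup>T v > 0\<close>.\<close>

lemma perron_pair:
  fixes Q :: "real ^ 'n ^ 'n"
  assumes Q: "\<And>i j. i \<noteq> j \<Longrightarrow> Q $ i $ j > 0"
  obtains v w l where "\<And>i. v $ i > 0" "\<And>i. w $ i > 0"
    "Q *v v = l *\<^sub>R v" "transpose Q *v w = l *\<^sub>R w"
proof -
  obtain v l where v: "\<forall>i. v $ i > 0" "Q *v v = l *\<^sub>R v"
    using positive_eigenvector[of Q] Q by blast
  obtain w m where w: "\<forall>i. w $ i > 0" "transpose Q *v w = m *\<^sub>R w"
    using positive_eigenvector[of "transpose Q"] Q by (auto simp: transpose_def)
  have "m * (w \<bullet> v) = (transpose Q *v w) \<bullet> v" unfolding w(2) by simp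
  also have "\<dots> = w \<bullet> (Q *v v)" by (simp add: dot_lmul_matrix)
  also have "\<dots> = l * (w \<bullet> v)" by (simp add: v)
  finally have "m * (w \<bullet> v) = l * (w \<bullet> v)" .
  moreover have "w \<bullet> v > 0"
    using v w by (auto simp: inner_vec_def intro!: sum_pos)
  ultimately have "m = l" by simp
  with v w that show ?thesis by blast
qed


section \<open>The variational formula\<close>

text \<open>With \<open>g = ln (u / v)\<close>, the inequality \<open>e\<^sup>x \<ge> 1 + x\<close> at \<open>x = g(j) - g(i)\<close> bounds each
  off-diagonal term from below. On the diagonal \<open>x = 0\<close> and it is an equality, so the negative
  entries of \<open>Q\<close> do no harm.\<close>

lemma perron_measure_rate_ge:
  fixes Q :: "real ^ 'n ^ 'n"
  assumes Q: "\<And>i j. i \<noteq> j \<Longrightarrow> Q $ i $ j > 0"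
    and v: "\<And>i. v $ i > 0" and w: "\<And>i. w $ i > 0"
    and Qv: "Q *v v = l *\<^sub>R v" and Qw: "transpose Q *v w = l *\<^sub>R w"
    and u: "\<And>i. u i > 0"
  shows "(\<Sum>i\<in>UNIV. \<Sum>j\<in>UNIV. Q $ i $ j * (w $ i * v $ i) * u j / u i) \<ge> l * (w \<bullet> v)"
proof -
  define g where "g i = ln (u i / v $ i)" for i
  have Qv': "(\<Sum>j\<in>UNIV. Q $ i $ j * v $ j) = l * v $ i" for i
    using arg_cong[OF Qv, of "\<lambda>x. x $ i"] by (simp add: matrix_vector_mult_def)
  have Qw': "(\<Sum>i\<in>UNIV. Q $ i $ j * w $ i) = l * w $ j" for j
    using arg_cong[OF Qw, of "\<lambda>x. x $ j"] by (simp add: matrix_vector_mult_def transpose_def)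
  have tangent: "w $ i * Q $ i $ j * v $ j * (1 + g j - g i)
      \<le> Q $ i $ j * (w $ i * v $ i) * u j / u i" for i j
  proof (cases "i = j")
    case True
    then show ?thesis using u[of i] by simp
  next
    case False
    have "exp (g j - g i) = (u j / v $ j) / (u i / v $ i)"
      using u v by (simp add: g_def exp_diff)
    moreover have "1 + (g j - g i) \<le> exp (g j - g i)" by (rule exp_ge_add_one_self)
    ultimately have "1 + g j - g i \<le> (u j / v $ j) / (u i / v $ i)" by simp
    then have "w $ i * Q $ i $ j * v $ j * (1 + g j - g i)
      \<le> w $ i * Q $ i $ j * v $ j * ((u j / v $ j) / (u i / v $ i))"
      using Q[OF False] w[of i] v[of j] by (intro mult_left_mono) (auto simp: less_imp_le)
    also have "\<dots> = Q $ i $ j * (w $ i * v $ i) * u j / u i"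
      using v[of j] by (simp add: field_simps)
    finally show ?thesis .
  qed
  have 1: "(\<Sum>i\<in>UNIV. \<Sum>j\<in>UNIV. w $ i * Q $ i $ j * v $ j) = l * (w \<bullet> v)"
    by (simp add: mult.assoc Qv' inner_vec_def mult.left_commute
        flip: sum_distrib_left)
  (* Both sums of the terms linear in g reduce to the same value, one by the equation for v and
     the other by the equation for w, so they cancel. *)
  have 2: "(\<Sum>i\<in>UNIV. \<Sum>j\<in>UNIV. w $ i * Q $ i $ j * v $ j * g i) = (\<Sum>i\<in>UNIV. l * w $ i * v $ i * g i)"
  proof (rule sum.cong[OF refl])
    fix i
    have "(\<Sum>j\<in>UNIV. w $ i * Q $ i $ j * v $ j * g i) = w $ i * g i * (\<Sum>j\<in>UNIV. Q $ i $ j * v $ j)"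
      by (simp add: sum_distrib_left mult_ac)
    then show "(\<Sum>j\<in>UNIV. w $ i * Q $ i $ j * v $ j * g i) = l * w $ i * v $ i * g i"
      by (simp add: Qv')
  qed
  have 3: "(\<Sum>i\<in>UNIV. \<Sum>j\<in>UNIV. w $ i * Q $ i $ j * v $ j * g j) = (\<Sum>j\<in>UNIV. l * w $ j * v $ j * g j)"
  proof (subst sum.swap, rule sum.cong[OF refl])
    fix j
    have "(\<Sum>i\<in>UNIV. w $ i * Q $ i $ j * v $ j * g j) = v $ j * g j * (\<Sum>i\<in>UNIV. Q $ i $ j * w $ i)"
      by (simp add: sum_distrib_left mult_ac)
    then show "(\<Sum>i\<in>UNIV. w $ i * Q $ i $ j * v $ j * g j) = l * w $ j * v $ j * g j"
      by (simp add: Qw')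
  qed
  have "l * (w \<bullet> v) = (\<Sum>i\<in>UNIV. \<Sum>j\<in>UNIV. w $ i * Q $ i $ j * v $ j * (1 + g j - g i))"
    using 1 2 3 by (simp add: ring_distribs sum.distrib sum_subtractf)
  also have "\<dots> \<le> (\<Sum>i\<in>UNIV. \<Sum>j\<in>UNIV. Q $ i $ j * (w $ i * v $ i) * u j / u i)"
    by (intro sum_mono tangent)
  finally show ?thesis .
qed

lemma variational_formula_eq_perron_eigenvalue:
  fixes Q :: "real ^ 'n ^ 'n"
  assumes Q: "\<And>i j. i \<noteq> j \<Longrightarrow> Q $ i $ j > 0"
    and v: "\<And>i. v $ i > 0" and w: "\<And>i. w $ i > 0"
    and Qv: "Q *v v = l *\<^sub>R v" and Qw: "transpose Q *v w = l *\<^sub>R w"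
  shows "(SUP \<mu> \<in> space (prob_algebra (count_space (UNIV :: 'n set))).
      INF u \<in> {u :: 'n \<Rightarrow> real. \<forall>i. u i > 0}.
        ereal (\<Sum>i\<in>UNIV. \<Sum>j\<in>UNIV. Q $ i $ j * measure \<mu> {i} * u j / u i)) = ereal l"
    (is "(SUP \<mu> \<in> ?P. INF u \<in> ?U. ereal (?J \<mu> u)) = _")
proof (rule antisym)
  show "(SUP \<mu> \<in> ?P. INF u \<in> ?U. ereal (?J \<mu> u)) \<le> ereal l"
  proof (rule SUP_least)
    fix \<mu> assume mu: "\<mu> \<in> ?P"
    then have sets: "sets \<mu> = sets (count_space UNIV)" and "prob_space \<mu>"
      by (auto simp: space_prob_algebra)
    interpret prob_space \<mu> by fact
    have sp: "space \<mu> = UNIV" using sets_eq_imp_space_eq[OF sets] by simp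
    have tot: "(\<Sum>i\<in>UNIV. measure \<mu> {i}) = 1"
      using finite_measure_eq_sum_singleton[of UNIV] prob_space sets sp by simp
    have "(\<Sum>j\<in>UNIV. Q $ i $ j * measure \<mu> {i} * v $ j / v $ i) = l * measure \<mu> {i}" for i
    proof -
      have "(\<Sum>j\<in>UNIV. Q $ i $ j * measure \<mu> {i} * v $ j / v $ i)
          = measure \<mu> {i} / v $ i * (Q *v v) $ i"
        by (simp add: matrix_vector_mult_def sum_distrib_left mult_ac divide_inverse)
      also have "\<dots> = l * measure \<mu> {i}" using v[of i] by (simp add: Qv)
      finally show ?thesis .
    qed
    then have "?J \<mu> (\<lambda>i. v $ i) = l" by (simp add: tot flip: sum_distrib_left)
    moreover have "(INF u \<in> ?U. ereal (?J \<mu> u)) \<le> ereal (?J \<mu> (\<lambda>i. v $ i))"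
      by (rule INF_lower) (simp add: v)
    ultimately show "(INF u \<in> ?U. ereal (?J \<mu> u)) \<le> ereal l" by simp
  qed
next
  define z where "z = w \<bullet> v"
  have z: "z > 0" unfolding z_def using v w by (auto simp: inner_vec_def intro!: sum_pos)
  define p where "p i = w $ i * v $ i / z" for i
  have p0: "p i \<ge> 0" for i using v[of i] w[of i] z by (simp add: p_def)
  have p1: "(\<Sum>i\<in>UNIV. p i) = 1"
    using z by (simp add: p_def inner_vec_def z_def flip: sum_divide_distrib)
  define \<mu> where "\<mu> = point_measure UNIV (\<lambda>i. ennreal (p i))"
  have single: "measure \<mu> {i} = p i" for i
    using p0 by (simp add: \<mu>_def measure_def emeasure_point_measure_finite)
  have "prob_space \<mu>"
    using p0 p1 by (intro prob_spaceI)
      (simp add: \<mu>_def space_point_measure emeasure_point_measure_finite sum_ennreal)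
  then have mu: "\<mu> \<in> ?P" by (simp add: space_prob_algebra \<mu>_def sets_point_measure)
  have "ereal l \<le> (INF u \<in> ?U. ereal (?J \<mu> u))"
  proof (rule INF_greatest)
    fix u :: "'n \<Rightarrow> real" assume "u \<in> ?U"
    then have "l * z \<le> (\<Sum>i\<in>UNIV. \<Sum>j\<in>UNIV. Q $ i $ j * (w $ i * v $ i) * u j / u i)"
      unfolding z_def by (intro perron_measure_rate_ge[OF Q v w Qv Qw]) auto
    also have "\<dots> = z * ?J \<mu> u"
      using z by (simp add: single p_def sum_distrib_left)
    finally show "ereal l \<le> ereal (?J \<mu> u)" using z by simp
  qed
  also have "\<dots> \<le> (SUP \<mu> \<in> ?P. INF u \<in> ?U. ereal (?J \<mu> u))" using mu by (rule SUP_upper)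
  finally show "ereal l \<le> (SUP \<mu> \<in> ?P. INF u \<in> ?U. ereal (?J \<mu> u))" .
qed


section \<open>The matrix exponential on an eigenvector\<close>

lemma abs_matrix_power_le:
  fixes A :: "real ^ 'n ^ 'n"
  shows "\<bar>matrix_power A k $ i $ j\<bar> \<le> (\<Sum>i\<in>UNIV. \<Sum>j\<in>UNIV. \<bar>A $ i $ j\<bar>) ^ k"
proof (induction k arbitrary: i)
  case 0
  then show ?case by (simp add: mat_def)
next
  case (Suc k)
  let ?K = "\<Sum>i\<in>UNIV. \<Sum>j\<in>UNIV. \<bar>A $ i $ j\<bar>"
  have "\<bar>matrix_power A (Suc k) $ i $ j\<bar> \<le> (\<Sum>m\<in>UNIV. \<bar>A $ i $ m\<bar> * \<bar>matrix_power A k $ m $ j\<bar>)"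
    by (auto simp: matrix_matrix_mult_def abs_mult intro!: order_trans[OF sum_abs])
  also have "\<dots> \<le> (\<Sum>m\<in>UNIV. \<bar>A $ i $ m\<bar> * ?K ^ k)"
    by (intro sum_mono mult_left_mono Suc) auto
  also have "\<dots> = (\<Sum>m\<in>UNIV. \<bar>A $ i $ m\<bar>) * ?K ^ k" by (simp add: sum_distrib_right)
  also have "\<dots> \<le> ?K * ?K ^ k"
    by (intro mult_right_mono member_le_sum[of i UNIV "\<lambda>i. \<Sum>j\<in>UNIV. \<bar>A $ i $ j\<bar>"])
      (auto intro!: sum_nonneg zero_le_power)
  finally show ?case by simp
qed

lemma summable_matrix_exp:
  fixes A :: "real ^ 'n ^ 'n"
  shows "summable (\<lambda>k. matrix_power A k /\<^sub>R fact k)"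
proof -
  let ?K = "\<Sum>i\<in>UNIV. \<Sum>j\<in>UNIV. \<bar>A $ i $ j\<bar>"
  let ?N = "real (CARD('n) * CARD('n))"
  have "norm (matrix_power A k) \<le> ?N * ?K ^ k" for k
  proof -
    have "norm (matrix_power A k) \<le> (\<Sum>i\<in>UNIV. norm (matrix_power A k $ i))"
      by (simp add: norm_vec_def L2_set_le_sum)
    also have "\<dots> \<le> (\<Sum>i\<in>(UNIV::'n set). \<Sum>j\<in>(UNIV::'n set). ?K ^ k)"
      by (intro sum_mono order_trans[OF norm_le_l1_cart] abs_matrix_power_le)
    finally show ?thesis by simp
  qed
  then have le: "norm (matrix_power A k /\<^sub>R fact k) \<le> ?N * (?K ^ k /\<^sub>R fact k)" for k
    by (simp add: divide_simps)
  have "summable (\<lambda>k. ?N * (?K ^ k /\<^sub>R fact k))"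
    by (intro summable_mult summable_exp_generic)
  then show ?thesis
    by (rule summable_comparison_test'[where N = 0]) (rule le)
qed

lemma matrix_exp_eigenvector:
  fixes A :: "real ^ 'n ^ 'n"
  assumes A: "A *v v = r *\<^sub>R v"
  shows "matrix_exp A *v v = exp r *\<^sub>R v"
proof -
  have pow: "matrix_power A k *v v = r ^ k *\<^sub>R v" for k
  proof (induction k)
    case (Suc k)
    have "matrix_power A (Suc k) *v v = A *v (matrix_power A k *v v)"
      by (simp add: matrix_vector_mul_assoc)
    then show ?case by (simp add: Suc A matrix_vector_mult_scaleR)
  qed simp
  have "linear (\<lambda>B :: real ^ 'n ^ 'n. B *v v)"
    by (intro linearI)
      (simp_all add: matrix_vector_mult_add_rdistrib scaleR_matrix_vector_assoc)
  then have bl: "bounded_linear (\<lambda>B :: real ^ 'n ^ 'n. B *v v)"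
    by (simp add: linear_conv_bounded_linear)
  have "matrix_exp A *v v = (\<Sum>k. (matrix_power A k /\<^sub>R fact k) *v v)"
    unfolding matrix_exp_def by (rule bounded_linear.suminf[OF bl summable_matrix_exp])
  also have "\<dots> = (\<Sum>k. (r ^ k /\<^sub>R fact k) *\<^sub>R v)"
    by (simp add: pow scaleR_matrix_vector_assoc[symmetric])
  also have "\<dots> = exp r *\<^sub>R v"
    unfolding exp_def by (rule suminf_scaleR_left[symmetric, OF summable_exp_generic])
  finally show ?thesis .
qed


section \<open>Survival probabilities\<close>

lemma (in killed_markov_chain) survival_probability:
  assumes t: "0 \<le> t"
  shows "\<P>(\<omega> in P i. ereal t < \<zeta> \<omega>) = (\<Sum>j\<in>UNIV. matrix_exp (t *\<^sub>R Q) $ i $ j)"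
proof -
  have sets: "sets (P i) = sets M" and "prob_space (P i)"
    using law[of i] by (auto simp: space_prob_algebra)
  interpret prob_space "P i" by fact
  have sp: "space (P i) = space M" by (rule sets_eq_imp_space_eq[OF sets])
  have alive: "X t \<omega> = None \<longleftrightarrow> \<not> ereal t < \<zeta> \<omega>" if "\<omega> \<in> space M" for \<omega>
    using killed_iff[OF that t] by auto
  define A where "A j = {\<omega> \<in> space (P i). X t \<omega> = Some j \<and> ereal t < \<zeta> \<omega>}" for j
  have "A j \<in> sets (P i)" for j
  proof -
    have "A j = X t -` {Some j} \<inter> space M"
      using alive unfolding A_def sp by fastforce
    also have "\<dots> \<in> sets M" using X_measurable[OF t] by (rule measurable_sets) simp
    finally show ?thesis by (simp add: sets)
  qed
  then have "measure (P i) (\<Union>j\<in>UNIV. A j) = (\<Sum>j\<in>UNIV. measure (P i) (A j))"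
    by (intro finite_measure_finite_Union) (auto simp: disjoint_family_on_def A_def)
  moreover have "(\<Union>j\<in>UNIV. A j) = {\<omega> \<in> space (P i). ereal t < \<zeta> \<omega>}"
    using alive unfolding A_def sp by fastforce
  ultimately show ?thesis using transition[OF t, of i] by (simp add: A_def)
qed

text \<open>The bounds follow by applying the nonnegative matrix \<open>e\<^bsup>tQ\<^esup>\<close> to
  \<open>v / max v \<le> 1 \<le> v / min v\<close>.\<close>

lemma (in killed_markov_chain) survival_probability_bounds:
  assumes v: "\<And>i. v $ i > 0" and Qv: "Q *v v = l *\<^sub>R v" and t: "0 \<le> t"
  shows "v $ i / Max (range (($) v)) * exp (t * l) \<le> \<P>(\<omega> in P i. ereal t < \<zeta> \<omega>)"
    and "\<P>(\<omega> in P i. ereal t < \<zeta> \<omega>) \<le> v $ i / Min (range (($) v)) * exp (t * l)"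
proof -
  let ?E = "matrix_exp (t *\<^sub>R Q)" and ?p = "\<P>(\<omega> in P i. ereal t < \<zeta> \<omega>)"
  let ?a = "Min (range (($) v))" and ?b = "Max (range (($) v))"
  have E: "?E $ i $ j \<ge> 0" for j by (subst transition[OF t, symmetric]) simp
  have "(t *\<^sub>R Q) *v v = (t * l) *\<^sub>R v" by (simp add: Qv flip: scaleR_matrix_vector_assoc)
  then have "?E *v v = exp (t * l) *\<^sub>R v" by (rule matrix_exp_eigenvector)
  then have Ev: "(\<Sum>j\<in>UNIV. ?E $ i $ j * v $ j) = exp (t * l) * v $ i"
    by (simp add: vec_eq_iff matrix_vector_mult_def)
  have a: "?a > 0" by (simp add: v)
  have ab: "?a \<le> v $ j" "v $ j \<le> ?b" for j by auto
  have b: "?b > 0" using v[of i] ab(2)[of i] by linarith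
  have "?p * ?a \<le> (\<Sum>j\<in>UNIV. ?E $ i $ j * v $ j)"
    unfolding survival_probability[OF t] sum_distrib_right
    by (intro sum_mono mult_left_mono E ab)
  then show "?p \<le> v $ i / ?a * exp (t * l)"
    using a unfolding Ev by (simp add: field_simps)
  have "(\<Sum>j\<in>UNIV. ?E $ i $ j * v $ j) \<le> ?p * ?b"
    unfolding survival_probability[OF t] sum_distrib_right
    by (intro sum_mono mult_left_mono E ab)
  then show "v $ i / ?b * exp (t * l) \<le> ?p"
    using b unfolding Ev by (simp add: field_simps)
qed

lemma exponential_rate_limit:
  fixes p :: "real \<Rightarrow> real"
  assumes c: "0 < c" and C: "0 < C"
    and lower: "\<And>t. 0 \<le> t \<Longrightarrow> c * exp (t * l) \<le> p t"
    and upper: "\<And>t. 0 \<le> t \<Longrightarrow> p t \<le> C * exp (t * l)"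
  shows "((\<lambda>t. 1 / t * ln (p t)) \<longlongrightarrow> l) at_top"
proof -
  have lim: "((\<lambda>t. ln k / t + l) \<longlongrightarrow> l) at_top" for k :: real
    using tendsto_add[OF tendsto_divide_0[OF tendsto_const
          filterlim_at_top_imp_at_infinity[OF filterlim_ident]] tendsto_const] by simp
  show ?thesis
  proof (rule tendsto_sandwich[OF _ _ lim lim])
    have *: "ln k / t + l = 1 / t * ln (k * exp (t * l))" if "k > 0" "t > 0" for k t :: real
      using that by (simp add: ln_mult field_simps)
    show "\<forall>\<^sub>F t in at_top. ln c / t + l \<le> 1 / t * ln (p t)"
      using eventually_gt_at_top[of 0]
    proof eventually_elim
      case (elim t)
      have "ln (c * exp (t * l)) \<le> ln (p t)" using lower[of t] c elim by (intro ln_mono) auto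
      then show ?case using elim c by (subst *) (auto intro: divide_right_mono)
    qed
    show "\<forall>\<^sub>F t in at_top. 1 / t * ln (p t) \<le> ln C / t + l"
      using eventually_gt_at_top[of 0]
    proof eventually_elim
      case (elim t)
      have "0 < c * exp (t * l)" using c by simp
      then have "0 < p t" using lower[of t] elim by linarith
      then have "ln (p t) \<le> ln (C * exp (t * l))" using upper[of t] elim by (intro ln_mono) auto
      then show ?case using elim C by (subst *) (auto intro: divide_right_mono)
    qed
  qed
qed

theorem corollary1p5:
  fixes M :: "'w measure"
    and P :: "'n::finite \<Rightarrow> 'w measure"
    and X :: "real \<Rightarrow> 'w \<Rightarrow> 'n option"
    and \<zeta> :: "'w \<Rightarrow> ereal"
    and Q :: "real ^ 'n ^ 'n"
    and i\<^sub>0 :: 'n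
  assumes "CARD('n) \<ge> 2"
    and "killed_markov_chain M P X \<zeta> Q"
    and "\<And>i. 0 < - (Q $ i $ i)"
    and "\<And>i j. i \<noteq> j \<Longrightarrow> Q $ i $ j > 0"
    and "\<And>i. (\<Sum>j\<in>UNIV. Q $ i $ j) \<le> 0"
  shows "((\<lambda>t::real. ereal (1 / t * ln \<P>(\<omega> in P i\<^sub>0. ereal t < \<zeta> \<omega>))) \<longlongrightarrow>
    (SUP \<mu> \<in> space (prob_algebra (count_space (UNIV :: 'n set))).
      INF u \<in> {u :: 'n \<Rightarrow> real. \<forall>i. u i > 0}.
        ereal (\<Sum>i\<in>UNIV. \<Sum>j\<in>UNIV. Q $ i $ j * measure \<mu> {i} * u j / u i))) at_top"
proof -
  interpret killed_markov_chain M P X \<zeta> Q by fact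
  note Q = assms(4)
  obtain v w l where v: "\<And>i. v $ i > 0" and w: "\<And>i. w $ i > 0"
    and Qv: "Q *v v = l *\<^sub>R v" and Qw: "transpose Q *v w = l *\<^sub>R w"
    using perron_pair[of Q] Q by blast
  have "Min (range (($) v)) > 0" "Max (range (($) v)) > 0"
    using v by (auto simp: Max_gr_iff)
  then have "((\<lambda>t. 1 / t * ln \<P>(\<omega> in P i\<^sub>0. ereal t < \<zeta> \<omega>)) \<longlongrightarrow> l) at_top"
    using v survival_probability_bounds[OF v Qv, of _ i\<^sub>0]
    by (intro exponential_rate_limit[of "v $ i\<^sub>0 / Max (range (($) v))"
          "v $ i\<^sub>0 / Min (range (($) v))"]) simp_all
  then show ?thesis
    by (subst variational_formula_eq_perron_eigenvalue[OF Q v w Qv Qw]) (auto intro: tendsto_ereal)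
qed

end
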